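(* Let $\mathsf{H}\neq\{0\}$ be a (right) quaternionic Hilbert space and let $T:\mathsf{H}\to\mathsf{H}$ be a right $\mathbb{H}$-linear operator that is compact and normal. Let $\sigma_S(T)$ be its spherical spectrum and $\sigma_{pS}(T)$ its spherical point spectrum. Then there exists $\lambda\in\sigma_{pS}(T)$ such that $$|\lambda|=\max\{|\mu| : \mu\in\sigma_S(T)\}=\|T\|.$$
   Context: $\mathbb{H}$ denotes the skew field of quaternions, with conjugation $q\mapsto\overline{q}$ and norm $|q|=\sqrt{\overline{q}q}$. A (right) quaternionic Hilbert space is a right $\mathbb{H}$-module $\mathsf{H}$ with a map $\mathsf{H}\times\mathsf{H}\ni(u,v)\mapsto\langle u|v\rangle\in\mathbb{H}$ such that $\langle u|vp+wq\rangle=\langle u|v\rangle p+\langle u|w\rangle q$, $\langle u|v\rangle=\overline{\langle v|u\rangle}$, $\langle u|u\rangle$ is a real number $\ge 0$, and $\langle u|u\rangle=0$ implies $u=0$ (for all $u,v,w\in\mathsf{H}$, $p,q\in\mathbb{H}$), and which is complete for the norm $\|u\|=\sqrt{\langle u|u\rangle}$. A map $T:\mathsf{H}\to\mathsf{H}$ is right $\mathbb{H}$-linear if $T(ua+vb)=(Tu)a+(Tv)b$ for all $u,v\in\mathsf{H}$, $a,b\in\mathbb{H}$. It is bounded if $\|T\|:=\sup_{u\neq0}\|Tu\|/\|u\|<\infty$; $\mathfrak{B}(\mathsf{H})$ is the set of bounded right $\mathbb{H}$-linear operators $\mathsf{H}\to\mathsf{H}$. A right $\mathbb{H}$-linear $T$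 is compact if it maps bounded sequences to sequences admitting convergent subsequences (compact operators are bounded). The adjoint $T^*$ of $T\in\mathfrak{B}(\mathsf{H})$ is defined by $\langle T^*u|v\rangle=\langle u|Tv\rangle$ for all $u,v$; $T$ is normal if $TT^*=T^*T$. For $T\in\mathfrak{B}(\mathsf{H})$ and $q\in\mathbb{H}$ put $\Delta_q(T):=T^2-T(q+\overline{q})+\mathrm{I}|q|^2$, where $\mathrm{I}$ is the identity and for $r\in\mathbb{R}$ the operator $Tr$ is $u\mapsto (Tu)r$. The spherical resolvent set $\rho_S(T)$ is the set of $q\in\mathbb{H}$ such that $\mathrm{Ker}(\Delta_q(T))=\{0\}$, $\mathrm{Range}(\Delta_q(T))$ is dense in $\mathsf{H}$, and $\Delta_q(T)^{-1}:\mathrm{Range}(\Delta_q(T))\to\mathsf{H}$ is bounded. The spherical spectrum is $\sigma_S(T):=\mathbb{H}\setminus\rho_S(T)$, and the spherical point spectrum is $\sigma_{pS}(T):=\{q\in\mathbb{H} : \mathrm{Ker}(\Delta_q(T))\neq\{0\}\}$. *)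

theory Defs
  imports "HOL-Analysis.Analysis"
begin

section \<open>Quaternions\<close>

codatatype quat = Quat (qRe: real) (qI: real) (qJ: real) (qK: real)

lemma quat_eq_iff:
  "x = y \<longleftrightarrow> qRe x = qRe y \<and> qI x = qI y \<and> qJ x = qJ y \<and> qK x = qK y"
  by (auto intro: quat.expand)

instantiation quat :: ab_group_add
begin

primcorec zero_quat where
  "qRe 0 = 0" | "qI 0 = 0" | "qJ 0 = 0" | "qK 0 = 0"

primcorec plus_quat where
  "qRe (x + y) = qRe x + qRe y"
| "qI (x + y) = qI x + qI y"
| "qJ (x + y) = qJ x + qJ y"
| "qK (x + y) = qK x + qK y"

primcorec uminus_quat where
  "qRe (- x) = - qRe x" | "qI (- x) = - qI x" | "qJ (- x) = - qJ x" | "qK (- x) = - qK x"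

primcorec minus_quat where
  "qRe (x - y) = qRe x - qRe y"
| "qI (x - y) = qI x - qI y"
| "qJ (x - y) = qJ x - qJ y"
| "qK (x - y) = qK x - qK y"

instance
  by standard (simp_all add: quat_eq_iff)

end

instantiation quat :: ring_1
begin

primcorec one_quat where
  "qRe 1 = 1" | "qI 1 = 0" | "qJ 1 = 0" | "qK 1 = 0"

primcorec times_quat where
  "qRe (x * y) = qRe x * qRe y - qI x * qI y - qJ x * qJ y - qK x * qK y"
| "qI (x * y) = qRe x * qI y + qI x * qRe y + qJ x * qK y - qK x * qJ y"
| "qJ (x * y) = qRe x * qJ y - qI x * qK y + qJ x * qRe y + qK x * qI y"
| "qK (x * y) = qRe x * qK y + qI x * qJ y - qJ x * qI y + qK x * qRe y"

instance
  by standard (simp_all add: quat_eq_iff algebra_simps)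

end

primcorec qcnj :: "quat \<Rightarrow> quat" where
  "qRe (qcnj x) = qRe x" | "qI (qcnj x) = - qI x" | "qJ (qcnj x) = - qJ x" | "qK (qcnj x) = - qK x"

instantiation quat :: real_algebra_1
begin

primcorec scaleR_quat where
  "qRe (r *\<^sub>R x) = r * qRe x"
| "qI (r *\<^sub>R x) = r * qI x"
| "qJ (r *\<^sub>R x) = r * qJ x"
| "qK (r *\<^sub>R x) = r * qK x"

instance
  by standard (simp_all add: quat_eq_iff algebra_simps)

end

lemma of_real_quat_sel [simp]:
  "qRe (of_real r) = r" "qI (of_real r) = 0" "qJ (of_real r) = 0" "qK (of_real r) = 0"
  by (simp_all add: of_real_def)

instantiation quat :: real_normed_div_algebra
begin

definition norm_quat :: "quat \<Rightarrow> real" where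
  "norm q = sqrt (qRe (qcnj q * q))"

definition inverse_quat :: "quat \<Rightarrow> quat" where
  "inverse q = (1 / (norm q)\<^sup>2) *\<^sub>R qcnj q"

definition divide_quat :: "quat \<Rightarrow> quat \<Rightarrow> quat" where
  "x div y = x * inverse (y::quat)"

definition sgn_quat :: "quat \<Rightarrow> quat" where
  "sgn (q::quat) = inverse (norm q) *\<^sub>R q"

definition dist_quat :: "quat \<Rightarrow> quat \<Rightarrow> real" where
  "dist (x::quat) y = norm (x - y)"

definition uniformity_quat :: "(quat \<times> quat) filter" where
  "uniformity_quat = (INF e\<in>{0 <..}. principal {(x, y). dist x y < e})"

definition open_quat :: "quat set \<Rightarrow> bool" where
  "open_quat U \<longleftrightarrow> (\<forall>x\<in>U. eventually (\<lambda>(x', y). x' = x \<longrightarrow> y \<in> U) uniformity)"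

instance
proof
  have norm_def: "norm q = norm ((qRe q, qI q), (qJ q, qK q))" for q :: quat
    by (simp add: norm_quat_def norm_Pair power2_eq_square)
  have norm2: "(norm q)\<^sup>2 = (qRe q)\<^sup>2 + (qI q)\<^sup>2 + (qJ q)\<^sup>2 + (qK q)\<^sup>2" for q :: quat
    by (simp add: norm_def norm_Pair)
  fix x y :: quat and r :: real and U :: "quat set"
  show norm0: "norm x = 0 \<longleftrightarrow> x = 0"
    by (simp add: norm_def quat_eq_iff zero_prod_def)
  show "norm (x + y) \<le> norm x + norm y"
    using norm_triangle_ineq[of "((qRe x, qI x), (qJ x, qK x))" "((qRe y, qI y), (qJ y, qK y))"]
    by (simp add: norm_def)
  show "norm (r *\<^sub>R x) = \<bar>r\<bar> * norm x"
    using norm_scaleR[of r "((qRe x, qI x), (qJ x, qK x))"] by (simp add: norm_def)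
  have "(norm (x * y))\<^sup>2 = (norm x * norm y)\<^sup>2"
    unfolding power_mult_distrib norm2 times_quat.sel by algebra
  then show "norm (x * y) = norm x * norm y"
    by (rule power2_eq_imp_eq) (simp_all add: norm_def)
  have cnj: "qcnj x * x = of_real ((norm x)\<^sup>2)" "x * qcnj x = of_real ((norm x)\<^sup>2)"
    unfolding norm2 by (simp_all add: quat_eq_iff power2_eq_square)
  show "inverse x * x = 1" "x * inverse x = 1" if "x \<noteq> 0"
    using that norm0 cnj by (simp_all add: inverse_quat_def of_real_def)
  show "inverse (0::quat) = 0"
    by (simp add: inverse_quat_def quat_eq_iff)
  show "(uniformity :: (quat \<times> quat) filter) = (INF e\<in>{0 <..}. principal {(x, y). dist x y < e})"
    by (rule uniformity_quat_def)
qed (simp_all add: divide_quat_def sgn_quat_def dist_quat_def open_quat_def)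

end

lemma qcnj_mult_self: "qcnj q * q = of_real ((norm q)\<^sup>2)"
  by (simp add: norm_quat_def quat_eq_iff)


section \<open>Right quaternionic Hilbert spaces\<close>

text \<open>
  The last two assumptions identify the real scalar multiplication and the real inner product of
  the superclass with the ones induced by the quaternionic structure. Given them, the assumptions
  of \<^class>\<open>real_inner\<close> (real bilinearity, symmetry and definiteness of \<open>inner\<close>, and the definitions of
  norm, metric and topology from \<open>inner\<close>) are consequences of the remaining ones or definitional,
  so the superclass imposes no further restriction.
\<close>

class quaternionic_inner = real_inner +
  fixes qscale :: "'a \<Rightarrow> quat \<Rightarrow> 'a"  (infixl "*\<^sub>Q" 75)
    and qinner :: "'a \<Rightarrow> 'a \<Rightarrow> quat"
  assumes qscale_add_left: "(u + v) *\<^sub>Q p = u *\<^sub>Q p + v *\<^sub>Q p"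
    and qscale_add_right: "u *\<^sub>Q (p + q) = u *\<^sub>Q p + u *\<^sub>Q q"
    and qscale_mult: "u *\<^sub>Q (p * q) = u *\<^sub>Q p *\<^sub>Q q"
    and qscale_one: "u *\<^sub>Q 1 = u"
    and qinner_linear_right: "qinner u (v *\<^sub>Q p + w *\<^sub>Q q) = qinner u v * p + qinner u w * q"
    and qinner_commute: "qinner u v = qcnj (qinner v u)"
    and qinner_self_real: "qinner u u \<in> \<real>"
    and qinner_self_ge_zero: "0 \<le> qRe (qinner u u)"
    and qinner_self_eq_zero: "qinner u u = 0 \<Longrightarrow> u = 0"
    and scaleR_eq_qscale: "r *\<^sub>R u = u *\<^sub>Q of_real r"
    and inner_eq_qRe_qinner: "inner u v = qRe (qinner u v)"

lemma norm_eq_sqrt_qinner: "norm u = sqrt (qRe (qinner u u))"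
  by (simp add: norm_eq_sqrt_inner inner_eq_qRe_qinner)

class quaternionic_hilbert = quaternionic_inner + complete_space


section \<open>Operators and the spherical spectrum\<close>

definition right_linear :: "('h::quaternionic_inner \<Rightarrow> 'h) \<Rightarrow> bool" where
  "right_linear T \<longleftrightarrow> (\<forall>u v a b. T (u *\<^sub>Q a + v *\<^sub>Q b) = T u *\<^sub>Q a + T v *\<^sub>Q b)"

definition compact_operator :: "('h::quaternionic_inner \<Rightarrow> 'h) \<Rightarrow> bool" where
  "compact_operator T \<longleftrightarrow> right_linear T \<and>
     (\<forall>X :: nat \<Rightarrow> 'h. Bseq X \<longrightarrow> (\<exists>r. strict_mono r \<and> convergent (\<lambda>n. T (X (r n)))))"

text \<open>
  The defining property determines the adjoint uniquely; for bounded right linear operators on a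
  quaternionic Hilbert space it exists by the Riesz representation theorem.
\<close>

definition qadjoint :: "('h::quaternionic_inner \<Rightarrow> 'h) \<Rightarrow> 'h \<Rightarrow> 'h" where
  "qadjoint T = (THE S. \<forall>u v. qinner (S u) v = qinner u (T v))"

definition normal_operator :: "('h::quaternionic_inner \<Rightarrow> 'h) \<Rightarrow> bool" where
  "normal_operator T \<longleftrightarrow> T \<circ> qadjoint T = qadjoint T \<circ> T"

definition Delta :: "quat \<Rightarrow> ('h::quaternionic_inner \<Rightarrow> 'h) \<Rightarrow> 'h \<Rightarrow> 'h" where
  "Delta q T u = T (T u) - T u *\<^sub>Q (q + qcnj q) + u *\<^sub>Q of_real ((norm q)\<^sup>2)"

definition op_kernel :: "('h::quaternionic_inner \<Rightarrow> 'h) \<Rightarrow> 'h set" where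
  "op_kernel A = {u. A u = 0}"

definition spherical_resolvent :: "('h::quaternionic_inner \<Rightarrow> 'h) \<Rightarrow> quat set" where
  "spherical_resolvent T = {q.
     op_kernel (Delta q T) = {0} \<and>
     closure (range (Delta q T)) = UNIV \<and>
     (\<exists>C. \<forall>v \<in> range (Delta q T). norm (inv (Delta q T) v) \<le> C * norm v)}"

definition spherical_spectrum :: "('h::quaternionic_inner \<Rightarrow> 'h) \<Rightarrow> quat set" where
  "spherical_spectrum T = - spherical_resolvent T"

definition spherical_point_spectrum :: "('h::quaternionic_inner \<Rightarrow> 'h) \<Rightarrow> quat set" where
  "spherical_point_spectrum T = {q. op_kernel (Delta q T) \<noteq> {0}}"

end

theory Submission
  imports Defs
begin

text \<open>
  Let \<open>M\<close> be the norm of \<open>T\<close>. By compactness \<open>M\<^sup>2\<close> is an eigenvalue of \<open>T\<^sup>*T\<close>. If \<open>M > 0\<close>, the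
  eigenspace \<open>V\<close> has compact unit ball, and by normality it is invariant under \<open>T\<close> and \<open>T\<^sup>*\<close>. So the
  self-adjoint operator \<open>T + T\<^sup>*\<close> has an eigenvector in \<open>V\<close>, with a real eigenvalue \<open>2a\<close> where
  \<open>\<bar>a\<bar> \<le> M\<close>. Applying \<open>T\<close> and using \<open>TT\<^sup>* = M\<^sup>2\<close> on \<open>V\<close>, the eigenvector lies in the kernel of
  \<open>T\<^sup>2 - 2aT + M\<^sup>2\<close>, which is \<open>\<Delta>\<^sub>q(T)\<close> for any \<open>q\<close> with real part \<open>a\<close> and modulus \<open>M\<close>.
  Conversely, \<open>\<Delta>\<^sub>q(T)\<close> is the product of the real linear maps \<open>u \<mapsto> Tu - uq\<close> and
  \<open>u \<mapsto> Tu - uq\<^sup>*\<close>, where \<open>q\<^sup>*\<close> is the conjugate of \<open>q\<close>; both are bijective with bounded inverse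
  when \<open>\<bar>q\<bar> > M\<close>.
\<close>

section \<open>Real Hilbert spaces\<close>

text \<open>Variational proof: a minimising sequence of a quadratic functional is Cauchy by the
  parallelogram law, and the first-order condition at its limit is the representation.\<close>

lemma riesz_representation:
  fixes f :: "'a::{real_inner, complete_space} \<Rightarrow> real"
  assumes f: "bounded_linear f"
  shows "\<exists>w. \<forall>x. inner w x = f x"
proof -
  interpret f: bounded_linear f by (rule f)
  \<comment> \<open>The representing vector is the minimiser of this functional.\<close>
  define g where "g x = inner x x - 2 * f x" for x
  obtain K where K: "\<And>x. norm (f x) \<le> norm x * K"
    using f.bounded by blast
  have lower: "- (K\<^sup>2) \<le> g x" for x
  proof -
    have "f x \<le> norm x * K" using K[of x] by simp
    moreover have "0 \<le> (norm x - K)\<^sup>2" by simp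
    ultimately show ?thesis
      unfolding g_def power2_norm_eq_inner[symmetric] by (simp add: power2_diff)
  qed
  have bdd: "bdd_below (range g)"
    using lower by (auto intro!: bdd_belowI)
  define d where "d = Inf (range g)"
  have d_le: "d \<le> g x" for x
    unfolding d_def using bdd by (auto intro: cInf_lower)
  have "\<exists>x. g x < d + 1 / real (Suc n)" for n
  proof -
    have "Inf (range g) < d + 1 / real (Suc n)" by (simp add: d_def)
    then show ?thesis using cInf_lessD[of "range g"] by auto
  qed
  then obtain X where X: "\<And>n. g (X n) < d + 1 / real (Suc n)" by metis
  \<comment> \<open>Parallelogram law: the linear parts cancel, so two near-minimisers, whose
    midpoint has value at least \<open>d\<close>, must be close together.\<close>
  have par: "g x + g y = 2 * g ((1/2) *\<^sub>R (x + y)) + (norm (x - y))\<^sup>2 / 2" for x y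
    unfolding g_def power2_norm_eq_inner
    by (simp add: inner_simps f.scaleR f.add inner_commute field_simps)
  have close: "(norm (X m - X n))\<^sup>2 < 2 / real (Suc m) + 2 / real (Suc n)" for m n
    using par[of "X m" "X n"] d_le[of "(1/2) *\<^sub>R (X m + X n)"] X[of m] X[of n] by simp
  have "Cauchy X"
  proof (rule metric_CauchyI)
    fix e :: real assume e: "e > 0"
    obtain N where N: "1 / real (Suc N) < e\<^sup>2 / 4"
      using reals_Archimedean[of "e\<^sup>2 / 4"] e by (auto simp: inverse_eq_divide)
    show "\<exists>N. \<forall>m\<ge>N. \<forall>n\<ge>N. dist (X m) (X n) < e"
    proof (intro exI allI impI)
      fix m n assume "N \<le> m" "N \<le> n"
      then have "1 / real (Suc m) \<le> 1 / real (Suc N)" "1 / real (Suc n) \<le> 1 / real (Suc N)"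
        by (auto intro!: divide_left_mono)
      with close[of m n] N have "(norm (X m - X n))\<^sup>2 < e\<^sup>2" by simp
      then show "dist (X m) (X n) < e"
        using e by (simp add: dist_norm power_less_imp_less_base)
    qed
  qed
  then obtain w where w: "X \<longlonglongrightarrow> w"
    using Cauchy_convergent convergent_def by blast
  have "(\<lambda>n. g (X n)) \<longlonglongrightarrow> g w"
    unfolding g_def by (intro tendsto_intros f.tendsto w)
  moreover have "(\<lambda>n. d + 1 / real (Suc n)) \<longlonglongrightarrow> d + 0"
    by (rule tendsto_add[OF tendsto_const LIMSEQ_Suc[OF lim_1_over_n]])
  ultimately have gw: "g w \<le> d"
    using X by (intro LIMSEQ_le[of _ "g w" _ d]) (auto intro: less_imp_le)
  have "inner w x = f x" for x
  proof (cases "x = 0")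
    case False
    define c where "c = inner w x - f x"
    \<comment> \<open>This \<open>t\<close> minimises the quadratic
      \<open>g (w + t *\<^sub>R x) - g w = t^2 * inner x x + 2 * t * c\<close>, whose minimum
      \<open>- c^2 / inner x x\<close> is nonnegative only if \<open>c = 0\<close>.\<close>
    define t where "t = - c / inner x x"
    have pos: "inner x x > 0" using False by simp
    have "g w \<le> g (w + t *\<^sub>R x)" using gw d_le order_trans by blast
    then have "0 \<le> t * t * inner x x + 2 * t * c"
      by (simp add: g_def c_def inner_simps f.add f.scaleR inner_commute algebra_simps)
    also have "\<dots> = - (c\<^sup>2 / inner x x)"
      using pos by (simp add: t_def field_simps power2_eq_square)
    finally have "c\<^sup>2 \<le> 0" using pos by (simp add: divide_le_0_iff)
    then show ?thesis by (simp add: c_def)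
  qed (simp add: f.zero)
  then show ?thesis by blast
qed

text \<open>Riesz applied to \<open>v \<mapsto> inner u (T v)\<close> gives \<open>S u\<close>; a
  bound for \<open>T\<close> passes to \<open>S\<close> by testing against
  \<open>v = S u\<close>.\<close>

lemma adjoint_exists_bounded_linear:
  fixes T :: "'a::{real_inner, complete_space} \<Rightarrow> 'a"
  assumes T: "bounded_linear T"
  shows "\<exists>S. bounded_linear S \<and> (\<forall>u v. inner (S u) v = inner u (T v))"
proof -
  interpret T: bounded_linear T by (rule T)
  have "\<exists>w. \<forall>v. inner w v = inner u (T v)" for u
    using riesz_representation[of "\<lambda>v. inner u (T v)"]
      bounded_linear_compose[OF bounded_linear_inner_right T] by blast
  then obtain S where S: "\<And>u v. inner (S u) v = inner u (T v)" by metis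
  obtain K where K: "\<And>x. norm (T x) \<le> norm x * K" and K0: "K > 0"
    using T.pos_bounded by blast
  have "bounded_linear S"
  proof (rule bounded_linear_intro)
    show "S (x + y) = S x + S y" for x y
      by (subst vector_eq_ldot[symmetric]) (metis S inner_add_left inner_commute)
    show "S (r *\<^sub>R x) = r *\<^sub>R S x" for r x
      by (subst vector_eq_ldot[symmetric]) (metis S inner_scaleR_left inner_commute)
    show "norm (S u) \<le> norm u * K" for u
    proof (cases "S u = 0")
      case False
      have "norm (S u) * norm (S u) = inner u (T (S u))"
        by (metis S power2_norm_eq_inner power2_eq_square)
      also have "\<dots> \<le> norm u * norm (T (S u))" by (rule norm_cauchy_schwarz)
      also have "\<dots> \<le> norm u * (norm (S u) * K)" by (intro mult_left_mono K) simp
      finally show ?thesis using False by (simp add: mult.left_commute)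
    qed (use K0 in simp)
  qed
  then show ?thesis using S by blast
qed

text \<open>A sequence maximising \<open>norm (T v)\<close> on the unit sphere of \<open>V\<close>
  consists of approximate eigenvectors of \<open>S T\<close>, and compactness makes a subsequence
  converge. The relative form serves both the whole space and an eigenspace.\<close>

lemma max_singular_vector_exists:
  fixes T S :: "'a::real_inner \<Rightarrow> 'a"
  assumes T: "bounded_linear T" and S: "bounded_linear S"
    and adj: "\<And>u v. inner (S u) v = inner u (T v)"
    and V: "subspace V" "closed V" and v0: "v0 \<in> V" "v0 \<noteq> 0"
    and TV: "\<And>v. v \<in> V \<Longrightarrow> T v \<in> V" and SV: "\<And>v. v \<in> V \<Longrightarrow> S v \<in> V"
    and comp: "\<And>X::nat \<Rightarrow> 'a. (\<And>n. X n \<in> V) \<Longrightarrow> Bseq X \<Longrightarrow>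
      \<exists>r. strict_mono r \<and> convergent (\<lambda>n. T (X (r n)))"
  shows "\<exists>u\<in>V. \<exists>m\<ge>0. norm u = 1 \<and> S (T u) = m\<^sup>2 *\<^sub>R u \<and> (\<forall>v\<in>V. norm (T v) \<le> m * norm v)"
proof -
  interpret T: bounded_linear T by (rule T)
  interpret S: bounded_linear S by (rule S)
  define A where "A = (\<lambda>u. norm (T u)) ` {u\<in>V. norm u = 1}"
  define e where "e = (1 / norm v0) *\<^sub>R v0"
  have e: "e \<in> V" "norm e = 1"
    using v0 V by (auto simp: e_def intro: subspace_scale)
  have ne: "A \<noteq> {}" using e by (auto simp: A_def)
  obtain K where K: "\<And>x. norm (T x) \<le> norm x * K" using T.bounded by blast
  have bdd: "bdd_above A"
  proof (rule bdd_aboveI)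
    show "x \<le> K" if "x \<in> A" for x
      using that K unfolding A_def by (metis (mono_tags, lifting) imageE mem_Collect_eq mult_1)
  qed
  define m where "m = Sup A"
  have le1: "norm (T u) \<le> m" if "u \<in> V" "norm u = 1" for u
    unfolding m_def using bdd that by (intro cSup_upper) (auto simp: A_def)
  have m0: "m \<ge> 0" using le1[OF e] norm_ge_zero order_trans by blast
  have Tle: "norm (T v) \<le> m * norm v" if "v \<in> V" for v
  proof (cases "v = 0")
    case False
    have "norm (T ((1 / norm v) *\<^sub>R v)) \<le> m"
      using False that V by (intro le1) (auto intro: subspace_scale)
    then show ?thesis using False by (simp add: T.scaleR field_simps)
  qed (simp add: T.zero)
  \<comment> \<open>The bound \<open>m\<close> holds on \<open>V\<close> only; it passes to
    \<open>S\<close> because \<open>S v\<close> stays in \<open>V\<close>.\<close>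
  have Sle: "norm (S v) \<le> m * norm v" if "v \<in> V" for v
  proof (cases "S v = 0")
    case False
    have "norm (S v) * norm (S v) = inner v (T (S v))"
      by (metis adj power2_norm_eq_inner power2_eq_square)
    also have "\<dots> \<le> norm v * norm (T (S v))" by (rule norm_cauchy_schwarz)
    also have "\<dots> \<le> norm v * (m * norm (S v))" by (intro mult_left_mono Tle SV that) simp
    finally show ?thesis using False by (simp add: mult.left_commute)
  qed (use m0 in simp)
  show ?thesis
  proof (cases "m = 0")
    \<comment> \<open>Here \<open>T\<close> vanishes on \<open>V\<close>, so any unit vector works;
      the other case divides by \<open>m^2\<close>.\<close>
    case True
    then have "T e = 0" using le1[OF e] by simp
    then show ?thesis using e Tle True by (intro bexI[of _ e] exI[of _ 0]) (auto simp: S.zero)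
  next
    case False
    have "\<exists>u\<in>V. norm u = 1 \<and> m - 1 / real (Suc n) < norm (T u)" for n
    proof -
      have "m - 1 / real (Suc n) < Sup A" by (simp add: m_def)
      then obtain a where "a \<in> A" "m - 1 / real (Suc n) < a" using less_cSupD[OF ne] by blast
      then show ?thesis by (auto simp: A_def)
    qed
    then obtain X where X: "\<And>n. X n \<in> V" "\<And>n. norm (X n) = 1"
      "\<And>n. m - 1 / real (Suc n) < norm (T (X n))" by metis
    have "(\<lambda>n. m - 1 / real (Suc n)) \<longlonglongrightarrow> m - 0"
      by (rule tendsto_diff[OF tendsto_const LIMSEQ_Suc[OF lim_1_over_n]])
    then have "(\<lambda>n. m - 1 / real (Suc n)) \<longlonglongrightarrow> m" by simp
    then have lim: "(\<lambda>n. norm (T (X n))) \<longlonglongrightarrow> m"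
      by (rule real_tendsto_sandwich[rotated 2, OF _ tendsto_const])
        (intro always_eventually allI less_imp_le X(3), intro always_eventually allI le1 X(1,2))
    \<comment> \<open>The residual of the eigenvalue equation. Expanding its square and using
      \<open>Sle\<close> bounds it by \<open>m^4 - m^2 * (norm (T (X n)))^2\<close>, which tends to
      0.\<close>
    define D where "D u = S (T u) - m\<^sup>2 *\<^sub>R u" for u
    have D_le: "(norm (D (X n)))\<^sup>2 \<le> m^4 - m\<^sup>2 * (norm (T (X n)))\<^sup>2" for n
    proof -
      have "norm (S (T (X n))) \<le> m * norm (T (X n))" by (intro Sle TV X)
      then have 1: "(norm (S (T (X n))))\<^sup>2 \<le> m\<^sup>2 * (norm (T (X n)))\<^sup>2"
        by (metis norm_ge_zero power_mono power_mult_distrib)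
      have "(norm (D (X n)))\<^sup>2 = (norm (S (T (X n))))\<^sup>2
          - 2 * m\<^sup>2 * inner (S (T (X n))) (X n) + m\<^sup>2 * m\<^sup>2 * inner (X n) (X n)"
        unfolding D_def power2_norm_eq_inner by (simp add: inner_simps inner_commute algebra_simps)
      moreover have "inner (S (T (X n))) (X n) = (norm (T (X n)))\<^sup>2"
        by (simp add: adj power2_norm_eq_inner)
      moreover have "inner (X n) (X n) = 1"
        by (metis X(2) power2_norm_eq_inner one_power2)
      ultimately show ?thesis using 1 by (simp add: power4_eq_xxxx power2_eq_square)
    qed
    have "(\<lambda>n. m^4 - m\<^sup>2 * (norm (T (X n)))\<^sup>2) \<longlonglongrightarrow> m^4 - m\<^sup>2 * m\<^sup>2"
      by (intro tendsto_intros lim)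
    then have "(\<lambda>n. m^4 - m\<^sup>2 * (norm (T (X n)))\<^sup>2) \<longlonglongrightarrow> 0"
      by (simp add: power4_eq_xxxx power2_eq_square)
    then have "(\<lambda>n. (norm (D (X n)))\<^sup>2) \<longlonglongrightarrow> 0"
      by (rule real_tendsto_sandwich[rotated 2, OF tendsto_const])
        (intro always_eventually allI zero_le_power2, intro always_eventually allI D_le)
    then have D0: "(\<lambda>n. D (X n)) \<longlonglongrightarrow> 0"
      by (simp add: tendsto_norm_zero_iff)
    have "Bseq X" using X by (intro BseqI'[of _ 1]) simp
    then obtain r w where r: "strict_mono r" and w: "(\<lambda>n. T (X (r n))) \<longlonglongrightarrow> w"
      using comp X(1) by (metis convergent_def)
    have D0r: "(\<lambda>n. D (X (r n))) \<longlonglongrightarrow> 0"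
      using LIMSEQ_subseq_LIMSEQ[OF D0 r] by (simp add: o_def)
    \<comment> \<open>Since \<open>m^2 *\<^sub>R X n = S (T (X n)) - D (X n)\<close>, convergence of
      the images forces convergence of the vectors; the \<open>0\<close> is the limit of the
      residuals.\<close>
    define u where "u = (1 / m\<^sup>2) *\<^sub>R (S w - 0)"
    have "(\<lambda>n. (1 / m\<^sup>2) *\<^sub>R (S (T (X (r n))) - D (X (r n)))) \<longlonglongrightarrow> u"
      unfolding u_def by (intro tendsto_intros S.tendsto w D0r)
    then have u: "(\<lambda>n. X (r n)) \<longlonglongrightarrow> u"
      using False by (simp add: D_def)
    have "u \<in> V" by (rule closed_sequentially[OF V(2) X(1) u])
    moreover have "norm u = 1"
      using tendsto_norm[OF u] by (simp add: X(2) LIMSEQ_const_iff)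
    moreover have "(\<lambda>n. D (X (r n))) \<longlonglongrightarrow> D u"
      unfolding D_def by (intro tendsto_intros S.tendsto T.tendsto u)
    then have "D u = 0" using D0r LIMSEQ_unique by blast
    ultimately show ?thesis using m0 Tle by (auto simp: D_def)
  qed
qed

text \<open>With \<open>S = T\<close> the extremal vector satisfies
  \<open>(T - m)(T + m) u = 0\<close>, so either \<open>u\<close> has eigenvalue \<open>- m\<close>,
  or \<open>(T + m) u\<close> is nonzero with eigenvalue \<open>m\<close>.\<close>

lemma selfadjoint_eigenvector_exists:
  fixes T :: "'a::real_inner \<Rightarrow> 'a"
  assumes T: "bounded_linear T"
    and adj: "\<And>u v. inner (T u) v = inner u (T v)"
    and V: "subspace V" "closed V" and v0: "v0 \<in> V" "v0 \<noteq> 0"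
    and TV: "\<And>v. v \<in> V \<Longrightarrow> T v \<in> V"
    and comp: "\<And>X::nat \<Rightarrow> 'a. (\<And>n. X n \<in> V) \<Longrightarrow> Bseq X \<Longrightarrow>
      \<exists>r. strict_mono r \<and> convergent (\<lambda>n. T (X (r n)))"
  shows "\<exists>u\<in>V. \<exists>c. u \<noteq> 0 \<and> T u = c *\<^sub>R u"
proof -
  interpret T: bounded_linear T by (rule T)
  obtain u m where u: "u \<in> V" "norm u = 1" "T (T u) = m\<^sup>2 *\<^sub>R u"
    using max_singular_vector_exists[OF T T adj V v0 TV TV comp] by blast
  show ?thesis
  proof (cases "T u + m *\<^sub>R u = 0")
    case True
    then have "T u = (- m) *\<^sub>R u" by (simp add: eq_neg_iff_add_eq_0)
    then show ?thesis using u by (metis norm_zero zero_neq_one)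
  next
    case False
    have "T (T u + m *\<^sub>R u) = m *\<^sub>R (T u + m *\<^sub>R u)"
      by (simp add: T.add T.scaleR u power2_eq_square algebra_simps)
    moreover have "T u + m *\<^sub>R u \<in> V"
      using u TV V by (auto intro: subspace_add subspace_scale)
    ultimately show ?thesis using False by blast
  qed
qed

section \<open>Quaternionic inner product spaces\<close>

lemma qinner_qscale_right: "qinner u (v *\<^sub>Q p) = qinner u v * p"
  by (metis add.right_neutral mult_zero_right qinner_linear_right scaleR_eq_qscale
      scaleR_zero_left of_real_0)

lemma qcnj_mult: "qcnj (p * q) = qcnj q * qcnj p"
  by (simp add: quat_eq_iff algebra_simps)

lemma norm_qcnj [simp]: "norm (qcnj q) = norm q"
  by (simp add: norm_quat_def)

lemma qcnj_add_self: "q + qcnj q = of_real (2 * qRe q)"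
  by (simp add: quat_eq_iff del: of_real_mult)

text \<open>\<open>qinner u u\<close> is real, hence central, so it can be pulled out of
  \<open>qcnj q * qinner u u * q\<close>.\<close>

lemma norm_qscale: "norm (u *\<^sub>Q q) = norm u * norm q"
proof -
  obtain r where r: "qinner u u = of_real r"
    using qinner_self_real[of u] by (auto elim: Reals_cases)
  have "qinner (u *\<^sub>Q q) (u *\<^sub>Q q) = qcnj (qinner u (u *\<^sub>Q q)) * q"
    by (metis qinner_commute qinner_qscale_right)
  also have "\<dots> = qcnj q * of_real r * q"
    by (simp add: qinner_qscale_right qcnj_mult r) (simp add: quat_eq_iff)
  also have "\<dots> = of_real (r * (norm q)\<^sup>2)"
    by (simp add: of_real_def qcnj_mult_self[unfolded of_real_def])
  finally have "(norm (u *\<^sub>Q q))\<^sup>2 = (norm u * norm q)\<^sup>2"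
    by (simp only: power_mult_distrib power2_norm_eq_inner inner_eq_qRe_qinner r of_real_quat_sel)
  then show ?thesis by (rule power2_eq_imp_eq) simp_all
qed

lemma qscale_diff_left: "(u - v) *\<^sub>Q p = u *\<^sub>Q p - v *\<^sub>Q p"
  by (metis add_diff_cancel_right' diff_add_cancel qscale_add_left)

text \<open>Multiplying by 1, i, j, k reads off all four components up to sign. This lifts
  identities from \<open>inner\<close> to \<open>qinner\<close>.\<close>

lemma quat_eqI_qRe_mult:
  assumes "\<And>q. qRe (x * q) = qRe (y * q)"
  shows "x = y"
  using assms[of 1] assms[of "Quat 0 1 0 0"] assms[of "Quat 0 0 1 0"] assms[of "Quat 0 0 0 1"]
  by (simp add: quat_eq_iff)

section \<open>Right linear operators\<close>

lemma right_linear_qscale: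
  assumes "right_linear T"
  shows "T (u *\<^sub>Q q) = T u *\<^sub>Q q"
proof -
  have zero: "v *\<^sub>Q 0 = 0" for v :: 'a
    using scaleR_eq_qscale[of 0 v] by simp
  have "T (u *\<^sub>Q q + u *\<^sub>Q 0) = T u *\<^sub>Q q + T u *\<^sub>Q 0"
    using assms unfolding right_linear_def by blast
  then show ?thesis by (simp add: zero)
qed

lemma right_linear_imp_linear:
  assumes "right_linear T"
  shows "linear T"
proof (rule linearI)
  show "T (u + v) = T u + T v" for u v
    using assms unfolding right_linear_def by (metis qscale_one)
  show "T (r *\<^sub>R u) = r *\<^sub>R T u" for r u
    by (simp add: scaleR_eq_qscale right_linear_qscale[OF assms])
qed

text \<open>Otherwise there are unit vectors whose \<open>n\<close>-th image has norm above
  \<open>n\<close>; no subsequence of the images is bounded, let alone convergent.\<close>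

lemma compact_operator_bounded_linear:
  assumes "compact_operator T"
  shows "bounded_linear T"
proof -
  have lin: "linear T"
    using assms right_linear_imp_linear by (auto simp: compact_operator_def)
  have "\<exists>B. \<forall>x. norm (T x) \<le> B * norm x"
  proof (rule ccontr)
    assume "\<not> ?thesis"
    then have "\<exists>x. real n * norm x < norm (T x)" for n :: nat
      by (metis not_less)
    then obtain X where X: "\<And>n. real n * norm (X n) < norm (T (X n))" by metis
    have X0: "X n \<noteq> 0" for n using X[of n] linear_0[OF lin] by auto
    define Y where "Y n = (1 / norm (X n)) *\<^sub>R X n" for n
    have TY: "real n < norm (T (Y n))" for n
      using X[of n] X0[of n] by (simp add: Y_def linear_scale[OF lin] field_simps)
    have "Bseq Y" using X0 by (intro BseqI'[of _ 1]) (simp add: Y_def)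
    then obtain r where r: "strict_mono r" "convergent (\<lambda>n. T (Y (r n)))"
      using assms unfolding compact_operator_def by blast
    then obtain K where K: "\<And>n. norm (T (Y (r n))) \<le> K"
      using convergent_imp_Bseq Bseq_def by metis
    obtain n where "K < real n" using reals_Archimedean2 by blast
    also have "real n \<le> real (r n)" using seq_suble[OF r(1)] by simp
    finally show False using TY[of "r n"] K[of n] by simp
  qed
  then show ?thesis using lin bounded_linear_axioms.intro
    by (metis bounded_linear.intro mult.commute)
qed

text \<open>The real adjoint is already the quaternionic one: replacing \<open>v\<close> by
  \<open>v *\<^sub>Q p\<close> in the real identity and using right linearity recovers every
  component. Uniqueness then identifies it with \<open>qadjoint T\<close>.\<close>

lemma qadjoint_bounded_linear:
  fixes T :: "'h::quaternionic_hilbert \<Rightarrow> 'h"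
  assumes lin: "right_linear T" and T: "bounded_linear T"
  shows "bounded_linear (qadjoint T)" and "inner (qadjoint T u) v = inner u (T v)"
proof -
  obtain S where S: "bounded_linear S" "\<And>u v. inner (S u) v = inner u (T v)"
    using adjoint_exists_bounded_linear[OF T] by blast
  have q: "qinner (S u) v = qinner u (T v)" for u v
  proof (rule quat_eqI_qRe_mult)
    show "qRe (qinner (S u) v * p) = qRe (qinner u (T v) * p)" for p
      using S(2)[of u "v *\<^sub>Q p"]
      by (simp add: inner_eq_qRe_qinner right_linear_qscale[OF lin] qinner_qscale_right)
  qed
  have "qadjoint T = S"
    unfolding qadjoint_def
  proof (rule the_equality)
    fix S' assume S': "\<forall>u v. qinner (S' u) v = qinner u (T v)"
    show "S' = S"
      by (rule ext, subst vector_eq_rdot[symmetric]) (simp add: inner_eq_qRe_qinner S' q)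
  qed (simp add: q)
  then show "bounded_linear (qadjoint T)" "inner (qadjoint T u) v = inner u (T v)"
    using S by auto
qed

section \<open>The spherical spectrum\<close>

text \<open>Right linearity lets \<open>qcnj q\<close> pass through \<open>T\<close>, so the cross
  terms add up to \<open>q + qcnj q\<close>. The factors are in general only real linear.\<close>

lemma Delta_eq_compose:
  assumes "right_linear T"
  shows "Delta q T u = T (T u - u *\<^sub>Q qcnj q) - (T u - u *\<^sub>Q qcnj q) *\<^sub>Q q"
  unfolding Delta_def qcnj_mult_self[symmetric] qscale_mult qscale_add_right qscale_diff_left
  by (simp add: linear_diff[OF right_linear_imp_linear[OF assms]] right_linear_qscale[OF assms])

text \<open>The coefficients are real, so only the real part and the modulus of \<open>q\<close>
  matter.\<close>

lemma Delta_eq_scaleR: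
  "Delta q T u = T (T u) - (2 * qRe q) *\<^sub>R T u + (norm q)\<^sup>2 *\<^sub>R u"
  unfolding Delta_def qcnj_add_self scaleR_eq_qscale ..

lemma spherical_point_spectrum_subset:
  "spherical_point_spectrum T \<subseteq> spherical_spectrum T"
  by (auto simp: spherical_point_spectrum_def spherical_spectrum_def spherical_resolvent_def)

section \<open>Invertibility of \<open>Delta q T\<close> outside the ball of radius
  \<open>onorm T\<close>\<close>

lemma right_shift_bounded_below:
  assumes "bounded_linear T"
  shows "(norm q - onorm T) * norm u \<le> norm (T u - u *\<^sub>Q q)"
proof -
  have "norm (u *\<^sub>Q q) \<le> norm (T u) + norm (T u - u *\<^sub>Q q)"
    by (metis norm_minus_commute norm_triangle_sub)
  then show ?thesis using onorm[OF assms, of u] by (simp add: norm_qscale algebra_simps)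
qed

text \<open>The equation is the fixed point problem
  \<open>u = (T u - v) *\<^sub>Q inverse q\<close>, a contraction with factor
  \<open>onorm T / norm q < 1\<close>.\<close>

lemma right_shift_surj:
  fixes T :: "'h::quaternionic_hilbert \<Rightarrow> 'h"
  assumes lin: "right_linear T" and T: "bounded_linear T" and q: "onorm T < norm q"
  shows "\<exists>u. T u - u *\<^sub>Q q = v"
proof -
  have q0: "norm q > 0" using q onorm_pos_le[OF T] by linarith
  then have qi: "inverse q * q = 1" by simp
  define F where "F u = (T u - v) *\<^sub>Q inverse q" for u
  have "\<exists>!u. F u = u"
  proof (rule banach_fix_type[of "onorm T / norm q"], safe)
    show "0 \<le> onorm T / norm q" using onorm_pos_le[OF T] by simp
    show "onorm T / norm q < 1" using q q0 by simp
    fix x y :: 'h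
    have "F x - F y = T (x - y) *\<^sub>Q inverse q"
      by (simp add: F_def qscale_diff_left[symmetric] linear_diff[OF right_linear_imp_linear[OF lin]])
    then have "dist (F x) (F y) = norm (T (x - y)) / norm q"
      by (simp add: dist_norm norm_qscale norm_inverse divide_inverse)
    also have "\<dots> \<le> (onorm T * norm (x - y)) / norm q"
      using q0 by (intro divide_right_mono onorm[OF T]) simp
    finally show "dist (F x) (F y) \<le> onorm T / norm q * dist x y" by (simp add: dist_norm)
  qed
  then obtain u where "F u = u" by blast
  then have "u *\<^sub>Q q = (T u - v) *\<^sub>Q inverse q *\<^sub>Q q" by (simp add: F_def)
  also have "\<dots> = T u - v" by (simp only: qscale_mult[symmetric] qi qscale_one)
  finally have "T u - u *\<^sub>Q q = v" by simp
  then show ?thesis by blast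
qed

lemma spherical_spectrum_norm_le:
  fixes T :: "'h::quaternionic_hilbert \<Rightarrow> 'h"
  assumes lin: "right_linear T" and T: "bounded_linear T" and q: "q \<in> spherical_spectrum T"
  shows "norm q \<le> onorm T"
proof (rule ccontr)
  assume "\<not> ?thesis"
  then have q: "onorm T < norm q" by simp
  define c where "c = norm q - onorm T"
  have c: "c > 0" using q by (simp add: c_def)
  \<comment> \<open>Each of the two factors is bounded below by \<open>c\<close>, as
    \<open>qcnj q\<close> and \<open>q\<close> have the same norm.\<close>
  have below: "c\<^sup>2 * norm u \<le> norm (Delta q T u)" for u
  proof -
    have "c * (c * norm u) \<le> c * norm (T u - u *\<^sub>Q qcnj q)"
      using right_shift_bounded_below[OF T, of "qcnj q" u] c by (simp add: c_def)
    also have "\<dots> \<le> norm (Delta q T u)"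
      unfolding Delta_eq_compose[OF lin] c_def by (rule right_shift_bounded_below[OF T])
    finally show ?thesis by (simp add: power2_eq_square mult.assoc)
  qed
  have zero: "Delta q T 0 = 0"
    using linear_0[OF right_linear_imp_linear[OF lin]] by (simp add: Delta_eq_scaleR)
  have ker0: "u = 0" if "Delta q T u = 0" for u
    using below[of u] that c by (simp add: mult_le_0_iff)
  have diff: "Delta q T x - Delta q T y = Delta q T (x - y)" for x y
    by (simp add: Delta_eq_scaleR linear_diff[OF right_linear_imp_linear[OF lin]] algebra_simps)
  have inj: "inj (Delta q T)"
    by (rule injI) (metis diff ker0 right_minus_eq)
  have "\<exists>x. v = Delta q T x" for v
  proof -
    obtain w where w: "T w - w *\<^sub>Q q = v" using right_shift_surj[OF lin T q] by blast
    obtain x where "T x - x *\<^sub>Q qcnj q = w" using right_shift_surj[OF lin T, of "qcnj q"] q by auto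
    then have "v = Delta q T x" using w by (simp add: Delta_eq_compose[OF lin])
    then show ?thesis by blast
  qed
  then have surj: "range (Delta q T) = UNIV" by (simp add: surj_def)
  have "norm (inv (Delta q T) v) \<le> (1 / c\<^sup>2) * norm v" for v
    using below[of "inv (Delta q T) v"] surj_f_inv_f[OF surj, of v] c by (simp add: field_simps)
  then have "\<exists>C. \<forall>v\<in>range (Delta q T). norm (inv (Delta q T) v) \<le> C * norm v" by fast
  moreover have "op_kernel (Delta q T) = {0}"
    using ker0 zero by (auto simp: op_kernel_def)
  ultimately have "q \<in> spherical_resolvent T"
    by (auto simp only: spherical_resolvent_def surj mem_Collect_eq closure_UNIV)
  then show False using assms(3) by (simp add: spherical_spectrum_def)
qed

section \<open>A point of the spherical point spectrum of modulus \<open>onorm T\<close>\<close>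

lemma compact_normal_point_spectrum_onorm:
  fixes T :: "'h::quaternionic_hilbert \<Rightarrow> 'h"
  assumes ne: "\<exists>u::'h. u \<noteq> 0" and comp: "compact_operator T" and normal: "normal_operator T"
  shows "\<exists>q \<in> spherical_point_spectrum T. norm q = onorm T"
proof -
  have lin: "right_linear T" using comp by (simp add: compact_operator_def)
  have T: "bounded_linear T" using comp by (rule compact_operator_bounded_linear)
  interpret T: bounded_linear T by (rule T)
  define S where "S = qadjoint T"
  have S: "bounded_linear S" and adj: "\<And>u v. inner (S u) v = inner u (T v)"
    using qadjoint_bounded_linear[OF lin T] by (auto simp: S_def)
  interpret S: bounded_linear S by (rule S)
  have TS: "T (S u) = S (T u)" for u
    using normal by (metis S_def comp_apply normal_operator_def)
  define M where "M = onorm T"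
  have comp': "\<exists>r. strict_mono r \<and> convergent (\<lambda>n. T (X (r n)))" if "Bseq X" for X :: "nat \<Rightarrow> 'h"
    using that comp by (simp add: compact_operator_def)
  obtain u0 :: 'h where u0: "u0 \<noteq> 0" using ne by blast
  obtain u m where u: "norm u = 1" "S (T u) = m\<^sup>2 *\<^sub>R u" "m \<ge> 0"
    and m: "\<And>v. norm (T v) \<le> m * norm v"
    using max_singular_vector_exists[OF T S adj subspace_UNIV closed_UNIV _ u0] comp' by auto
  \<comment> \<open>The bound \<open>m\<close> is attained at the unit vector \<open>u\<close>,
    which identifies it with the operator norm.\<close>
  have "(norm (T u))\<^sup>2 = inner (S (T u)) u" by (simp add: adj power2_norm_eq_inner)
  also have "\<dots> = m\<^sup>2 * (norm u)\<^sup>2" by (simp add: u(2) power2_norm_eq_inner)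
  finally have "norm (T u) = m" using u by (simp add: power2_eq_iff_nonneg)
  then have mM: "m = M"
    using onorm_bound[of m T] m u(3) onorm[OF T, of u] u(1) by (auto simp: M_def intro: antisym)
  have M0: "M \<ge> 0" using u mM by simp
  have kerI: "q \<in> spherical_point_spectrum T" if "Delta q T v = 0" "v \<noteq> 0" for q v
    using that by (auto simp: spherical_point_spectrum_def op_kernel_def)
  show ?thesis
  proof (cases "M = 0")
    case True
    then have "T v = 0" for v using m[of v] mM by simp
    then have "Delta 0 T u0 = 0" by (simp add: Delta_eq_scaleR)
    then show ?thesis using kerI u0 True by (auto simp: M_def)
  next
    case False
    define V where "V = {v. S (T v) = M\<^sup>2 *\<^sub>R v}"
    have V: "subspace V"
      by (rule subspaceI) (simp_all add: V_def T.zero S.zero T.add S.add T.scaleR S.scaleR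
          scaleR_add_right mult.commute)
    have cl: "closed V"
      unfolding V_def by (intro closed_Collect_eq continuous_intros
          linear_continuous_on S T continuous_on_compose2[OF linear_continuous_on[OF S]]) auto
    \<comment> \<open>On \<open>V\<close> the identity equals \<open>S T / M^2\<close>, hence is
      compact; so every bounded operator, in particular \<open>R\<close> below, is compact on
      \<open>V\<close>.\<close>
    have compV: "\<exists>r. strict_mono r \<and> convergent (\<lambda>n. X (r n))"
      if X: "\<And>n. X n \<in> V" "Bseq X" for X :: "nat \<Rightarrow> 'h"
    proof -
      obtain r w where r: "strict_mono r" and w: "(\<lambda>n. T (X (r n))) \<longlonglongrightarrow> w"
        using comp'[OF X(2)] by (auto simp: convergent_def)
      have "(\<lambda>n. (1 / M\<^sup>2) *\<^sub>R S (T (X (r n)))) \<longlonglongrightarrow> (1 / M\<^sup>2) *\<^sub>R S w"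
        by (intro tendsto_intros S.tendsto w)
      moreover have "(1 / M\<^sup>2) *\<^sub>R S (T (X (r n))) = X (r n)" for n
        using X(1)[of "r n"] False by (simp add: V_def)
      ultimately show ?thesis using r by (auto simp: convergent_def)
    qed
    define R where "R v = T v + S v" for v
    have R: "bounded_linear R" unfolding R_def by (intro bounded_linear_add T S)
    have uV: "u \<in> V" "u \<noteq> 0" using u mM by (auto simp: V_def)
    have "\<exists>v\<in>V. \<exists>c. v \<noteq> 0 \<and> R v = c *\<^sub>R v"
    proof (rule selfadjoint_eigenvector_exists[OF R _ V cl uV])
      show "inner (R x) y = inner x (R y)" for x y
        using adj[of x y] adj[of y x] by (simp add: R_def inner_simps inner_commute)
      \<comment> \<open>By normality \<open>S T\<close> commutes with both \<open>T\<close> and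
        \<open>S\<close>, so its eigenspace is invariant under their sum.\<close>
      show "R v \<in> V" if "v \<in> V" for v
        using that by (simp add: V_def R_def T.add S.add TS)
          (metis S.scaleR T.scaleR TS scaleR_add_right)
      fix X :: "nat \<Rightarrow> 'h" assume "\<And>n. X n \<in> V" "Bseq X"
      then obtain r w where "strict_mono r" "(\<lambda>n. X (r n)) \<longlonglongrightarrow> w"
        using compV by (metis convergent_def)
      then show "\<exists>r. strict_mono r \<and> convergent (\<lambda>n. R (X (r n)))"
        using bounded_linear.tendsto[OF R] convergent_def by blast
    qed
    then obtain v c where v: "v \<in> V" "v \<noteq> 0" "T v + S v = c *\<^sub>R v" by (auto simp: R_def)
    \<comment> \<open>Pairing the eigenvalue equation with \<open>v\<close> bounds
      \<open>c / 2\<close> by \<open>M\<close>, which keeps the radicand in \<open>q\<close>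
      nonnegative.\<close>
    have "c * inner v v = inner (T v + S v) v" by (simp add: v(3))
    also have "\<dots> = 2 * inner (T v) v"
      using adj[of v v] inner_commute[of v "T v"] by (simp add: inner_add_left)
    finally have "\<bar>c\<bar> * (norm v)\<^sup>2 = 2 * \<bar>inner (T v) v\<bar>"
      by (metis abs_mult abs_numeral abs_power2 power2_norm_eq_inner)
    also have "\<dots> \<le> 2 * (norm (T v) * norm v)" using Cauchy_Schwarz_ineq2 by simp
    also have "\<dots> \<le> 2 * (M * norm v * norm v)" using m[of v] mM by (simp add: mult_right_mono)
    finally have "\<bar>c\<bar> * (norm v)\<^sup>2 \<le> (2 * M) * (norm v)\<^sup>2"
      by (simp add: power2_eq_square mult.assoc)
    then have c: "\<bar>c / 2\<bar> \<le> M" using v(2) by simp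
    then have c2: "(c / 2)\<^sup>2 \<le> M\<^sup>2" by (metis abs_ge_zero power2_abs power_mono)
    define q where "q = Quat (c / 2) (sqrt (M\<^sup>2 - (c / 2)\<^sup>2)) 0 0"
    have "qRe (qcnj q * q) = M\<^sup>2"
      using c2 by (simp add: q_def flip: power2_eq_square)
    then have q: "norm q = M" using M0 by (simp add: norm_quat_def)
    \<comment> \<open>Applying \<open>T\<close> to \<open>T v + S v = c *\<^sub>R v\<close>
      eliminates \<open>S\<close> through \<open>T (S v) = M^2 *\<^sub>R v\<close>; since
      \<open>2 * qRe q = c\<close>, this is the kernel equation.\<close>
    have "T (T v) + T (S v) = c *\<^sub>R T v"
      by (metis T.add T.scaleR v(3))
    moreover have "T (S v) = M\<^sup>2 *\<^sub>R v" using v(1) TS by (simp add: V_def)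
    ultimately have "Delta q T v = 0"
      unfolding Delta_eq_scaleR q by (simp add: q_def algebra_simps)
    then show ?thesis using kerI v(2) q by (auto simp: M_def)
  qed
qed

theorem theorem1p1:
  fixes T :: "'h::quaternionic_hilbert \<Rightarrow> 'h"
  assumes "\<exists>u::'h. u \<noteq> 0"
    and "right_linear T"
    and "compact_operator T"
    and "normal_operator T"
  shows "\<exists>lam \<in> spherical_point_spectrum T.
    (norm lam \<in> norm ` spherical_spectrum T \<and> (\<forall>r \<in> norm ` spherical_spectrum T. r \<le> norm lam)) \<and>
    norm lam = onorm T"
proof -
  obtain q where q: "q \<in> spherical_point_spectrum T" "norm q = onorm T"
    using compact_normal_point_spectrum_onorm assms by blast
  moreover have "q \<in> spherical_spectrum T"
    using q spherical_point_spectrum_subset by blast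
  moreover have "norm p \<le> onorm T" if "p \<in> spherical_spectrum T" for p
    using spherical_spectrum_norm_le[OF assms(2) compact_operator_bounded_linear[OF assms(3)] that] .
  ultimately show ?thesis by auto
qed

end
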